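(* For every probability distribution $F\in\mathcal{F}$ on $[0,1]$ and every $\mu\in[0,1]$, $$\lim_{d\to\infty} D_{\min}^{(d)}\big(\mathrm{E}^{(d)}(F),\mu\big)=D_{\min}(F,\mu).$$
   Context: $\mathcal{F}$ is the family of all (Borel) probability distributions on $[0,1]$, and $\mathrm{E}_F[\cdot]$ denotes expectation when $X$ has distribution $F$. The Kullback-Leibler divergence is $D(F\Vert G)=\mathrm{E}_F[\log \frac{\mathrm{d}F}{\mathrm{d}G}]$ if the density $\frac{\mathrm{d}F}{\mathrm{d}G}$ exists, and $D(F\Vert G)=+\infty$ otherwise. For $F\in\mathcal{F}$ and $\mu\in[0,1]$, $$D_{\min}(F,\mu)=\min_{G\in\mathcal{F}:\,\mathrm{E}_G[X]\ge\mu} D(F\Vert G)\in[0,+\infty].$$ For an integer $d\ge 1$, $\mathrm{E}^{(d)}(F)=(\mathrm{E}_F[X],\dots,\mathrm{E}_F[X^d])$ denotes the vector of the first $d$ moments of $F$. For $\boldsymbol{M}=(M_1,\dots,M_d)$ let $\mathcal{F}(\boldsymbol{M})=\{F\in\mathcal{F}:\mathrm{E}^{(d)}(F)=\boldsymbol{M}\}$ and $$D_{\min}^{(d)}(\boldsymbol{M},\mu)=\inf_{F\in\mathcal{F}(\boldsymbol{M})}D_{\min}(F,\mu).$$ *)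

theory Defs
  imports "HOL-Probability.Probability"
begin

(* Distributions on [0,1] are Borel probability measures on the real line that give [0,1] mass 1. *)
definition unit_distrs :: "real measure set" where
  "unit_distrs = {F. prob_space F \<and> sets F = sets borel \<and> emeasure F {0..1} = 1}"

(* Expectation with values in the extended reals, E[h^+] - E[h^-]; the Bochner integral would give 0
   where the expectation is infinite. It is meaningful when one of the two parts is finite. *)
definition ext_expectation :: "'a measure \<Rightarrow> ('a \<Rightarrow> real) \<Rightarrow> ereal" where
  "ext_expectation M h =
     enn2ereal (\<integral>\<^sup>+ x. ennreal (h x) \<partial>M) - enn2ereal (\<integral>\<^sup>+ x. ennreal (- h x) \<partial>M)"

(* D(F || G), natural logarithm. The library's entropy_density (exp 1) G F is log (dF/dG), with the
   reference measure as first measure argument; its negative part always has finite F-expectation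
   for finite measures F, G. *)
definition KL_div :: "'a measure \<Rightarrow> 'a measure \<Rightarrow> ereal" where
  "KL_div F G =
     (if absolutely_continuous G F then ext_expectation F (entropy_density (exp 1) G F) else \<infinity>)"

lemma ext_expectation_eq_integral:
  assumes "integrable M h"
  shows "ext_expectation M h = ereal (integral\<^sup>L M h)"
proof -
  have fin: "(\<integral>\<^sup>+ x. ennreal (h x) \<partial>M) \<noteq> \<infinity>" "(\<integral>\<^sup>+ x. ennreal (- h x) \<partial>M) \<noteq> \<infinity>"
    using assms by (simp_all add: real_integrable_def)
  then obtain a b where ab: "0 \<le> a" "(\<integral>\<^sup>+ x. ennreal (h x) \<partial>M) = ennreal a"
      "0 \<le> b" "(\<integral>\<^sup>+ x. ennreal (- h x) \<partial>M) = ennreal b"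
    by (metis ennreal_cases infinity_ennreal_def)
  then show ?thesis
    using real_lebesgue_integral_def[OF assms] by (simp add: ext_expectation_def enn2ereal_ennreal)
qed

lemma KL_div_eq_KL_divergence:
  assumes "absolutely_continuous G F" and "integrable F (entropy_density (exp 1) G F)"
  shows "KL_div F G = ereal (KL_divergence (exp 1) G F)"
  using assms by (simp add: KL_div_def KL_divergence_def ext_expectation_eq_integral)

(* The minimum over G is written as an infimum; the two agree since the minimum is attained. *)
definition D_min :: "real measure \<Rightarrow> real \<Rightarrow> ereal" where
  "D_min F \<mu> = (INF G \<in> {G \<in> unit_distrs. (\<integral>x. x \<partial>G) \<ge> \<mu>}. KL_div F G)"

(* Vectors in R^d are lists of length d, because d varies. *)
definition moments :: "nat \<Rightarrow> real measure \<Rightarrow> real list" where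
  "moments d F = map (\<lambda>k. \<integral>x. x ^ k \<partial>F) [1..<d + 1]"

definition distrs_with_moments :: "nat \<Rightarrow> real list \<Rightarrow> real measure set" where
  "distrs_with_moments d M = {F \<in> unit_distrs. moments d F = M}"

definition D_min_moments :: "nat \<Rightarrow> real list \<Rightarrow> real \<Rightarrow> ereal" where
  "D_min_moments d M \<mu> = (INF F \<in> distrs_with_moments d M. D_min F \<mu>)"

end

theory Submission
  imports Defs
begin

text \<open>
  The minimisation in \<open>D_min F \<mu>\<close> is dual to maximising \<open>E\<^sub>F [ln (1 - (X - \<mu>) \<nu>)]\<close> over
  \<open>0 \<le> \<nu> < 1 / (1 - \<mu>)\<close>. The inequality \<open>ln x \<le> x - 1\<close> shows that every such \<open>\<nu>\<close> gives a lower
  bound for \<open>D_min\<close>. Conversely, if \<open>F\<close> has mean below \<open>\<mu>\<close>, either some admissible \<open>\<nu> > 0\<close> satisfies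
  \<open>E\<^sub>F [1 / (1 - (X - \<mu>) \<nu>)] = 1\<close>, and then the measure with this density with respect to \<open>F\<close> attains
  the bound; or this expectation is at most \<open>1\<close> up to the boundary value of \<open>\<nu>\<close>, and then the missing
  mass is placed at the point \<open>1\<close>.

  For a fixed \<open>\<nu> < 1 / (1 - \<mu>)\<close> the dual integrand is continuous on \<open>[0,1]\<close>, hence uniformly
  approximable by polynomials, and the expectation of a polynomial depends on finitely many moments
  only. So each dual lower bound for \<open>F\<close> holds, up to an arbitrarily small error, uniformly for all
  distributions sharing sufficiently many moments with \<open>F\<close>. For \<open>\<mu> = 1\<close> the first moment alone decides.
\<close>

section \<open>Adding a point mass to a measure\<close>

text \<open>Serves to place missing mass at the point \<open>1\<close>. Integrals of nonnegative
  functions give total mass and densities of \<open>N\<close> at once; the formula extends from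
  indicators by induction over measurable functions.\<close>

lemma obtain_measure_add_atom:
  fixes M :: "'a measure" and c :: ennreal
  assumes "a \<in> space M"
  obtains N where "sets N = sets M"
    and "\<And>f :: 'a \<Rightarrow> ennreal. f \<in> borel_measurable M \<Longrightarrow> (\<integral>\<^sup>+x. f x \<partial>N) = (\<integral>\<^sup>+x. f x \<partial>M) + c * f a"
proof -
  define m where "m A = emeasure M A + c * indicator A a" for A
  define N where "N = measure_of (space M) (sets M) m"
  have sets_N: "sets N = sets M" and space_N: "space N = space M"
    by (simp_all add: N_def)
  have em: "emeasure N A = m A" if "A \<in> sets M" for A
    unfolding N_def
  proof (rule emeasure_measure_of_sigma[OF _ _ _ that])
    show "countably_additive (sets M) m"
    proof (rule countably_additiveI)
      fix A :: "nat \<Rightarrow> 'a set"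
      assume A: "range A \<subseteq> sets M" "disjoint_family A" "(\<Union>i. A i) \<in> sets M"
      have "(\<Sum>i. m (A i)) = (\<Sum>i. emeasure M (A i)) + (\<Sum>i. c * indicator (A i) a)"
        unfolding m_def by (rule suminf_add[symmetric]) auto
      also have "(\<Sum>i. c * indicator (A i) a :: ennreal) = c * (\<Sum>i. indicator (A i) a)"
        by (rule ennreal_suminf_cmult)
      also have "(\<Sum>i. indicator (A i) a :: ennreal) = indicator (\<Union>i. A i) a"
        using A(2) by (rule suminf_indicator)
      also have "(\<Sum>i. emeasure M (A i)) = emeasure M (\<Union>i. A i)"
        using A by (intro suminf_emeasure) auto
      finally show "(\<Sum>i. m (A i)) = m (\<Union>i. A i)" by (simp add: m_def)
    qed
  qed (auto simp: m_def positive_def sets.sigma_algebra_axioms)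
  have meas: "f \<in> borel_measurable N \<longleftrightarrow> f \<in> borel_measurable M" for f :: "'a \<Rightarrow> ennreal"
    by (simp add: measurable_cong_sets[OF sets_N refl])
  have "(\<integral>\<^sup>+x. f x \<partial>N) = (\<integral>\<^sup>+x. f x \<partial>M) + c * f a" if "f \<in> borel_measurable M" for f
    using that
  proof induction
    case (cong f g)
    have "(\<integral>\<^sup>+x. f x \<partial>N) = (\<integral>\<^sup>+x. g x \<partial>N)"
      by (rule nn_integral_cong) (simp add: space_N cong)
    moreover have "(\<integral>\<^sup>+x. f x \<partial>M) = (\<integral>\<^sup>+x. g x \<partial>M)"
      by (rule nn_integral_cong) (simp add: cong)
    moreover have "f a = g a"
      using assms by (rule cong)
    ultimately show ?case using cong by simp
  next
    case (set A)
    then show ?case by (simp add: em sets_N m_def)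
  next
    case (mult u k)
    then show ?case by (simp add: nn_integral_cmult meas algebra_simps)
  next
    case (add u v)
    then show ?case by (simp add: nn_integral_add meas algebra_simps)
  next
    case (seq U)
    then have inc: "incseq (\<lambda>i. integral\<^sup>N M (U i))" "incseq (\<lambda>i. c * U i a)"
      by (auto simp: incseq_def le_fun_def intro!: nn_integral_mono mult_left_mono)
    have "(\<integral>\<^sup>+x. (SUP i. U i) x \<partial>N) = (SUP i. integral\<^sup>N M (U i) + c * U i a)"
      using seq by (simp add: SUP_apply nn_integral_monotone_convergence_SUP meas image_comp)
    also have "\<dots> = (SUP i. integral\<^sup>N M (U i)) + (SUP i. c * U i a)"
      by (rule ennreal_SUP_add[OF inc])
    also have "(SUP i. c * U i a) = c * (SUP i. U i a)"
      by (simp add: SUP_mult_left_ennreal)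
    also have "(SUP i. integral\<^sup>N M (U i)) = (\<integral>\<^sup>+x. (SUP i. U i) x \<partial>M)"
      using seq by (simp add: SUP_apply nn_integral_monotone_convergence_SUP image_comp)
    finally show ?case by (simp add: SUP_apply image_comp)
  qed
  then show thesis using that sets_N by blast
qed

section \<open>Bounding and evaluating the divergence\<close>

text \<open>With \<open>D\<close> the density of \<open>F\<close> with respect to \<open>G\<close>,
  integrate \<open>ln (w / D) \<le> w / D - 1\<close> over \<open>F\<close>. The right side has
  integral at most 0, since the \<open>F\<close>-expectation of \<open>w / D\<close> is at most the
  \<open>G\<close>-integral of \<open>w\<close>.\<close>

lemma KL_div_ge_integral_ln:
  fixes w :: "'a \<Rightarrow> real"
  assumes F: "prob_space F" and G: "finite_measure G" and sets_eq: "sets F = sets G"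
    and w[measurable]: "w \<in> borel_measurable G"
    and pos: "AE x in F. 0 < w x" and int_ln: "integrable F (\<lambda>x. ln (w x))"
    and le1: "(\<integral>\<^sup>+x. ennreal (w x) \<partial>G) \<le> 1"
  shows "ereal (\<integral>x. ln (w x) \<partial>F) \<le> KL_div F G"
\<comment> \<open>Otherwise the divergence is infinite: by definition, or since
  \<open>\<infinity> - c = \<infinity>\<close> in \<open>ereal\<close> for every \<open>c\<close>,
  even for \<open>c = \<infinity>\<close>.\<close>
proof (cases "absolutely_continuous G F \<and> (\<integral>\<^sup>+x. ennreal (entropy_density (exp 1) G F x) \<partial>F) \<noteq> \<infinity>")
  case False
  then have "KL_div F G = \<infinity>"
    by (auto simp: KL_div_def ext_expectation_def)
  then show ?thesis by simp
next
  case True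
  then have ac: "absolutely_continuous G F" by simp
  interpret F: prob_space F by fact
  interpret G: finite_measure G by fact
  let ?l = "entropy_density (exp 1) G F"
  obtain D where D[measurable]: "D \<in> borel_measurable G"
    and RN: "AE x in G. RN_deriv G F x = ennreal (D x)"
    and D_pos: "AE x in F. 0 < D x" and D_nn: "\<And>x. 0 \<le> D x"
    using G.real_RN_deriv[OF F.finite_measure_axioms ac sets_eq] by blast
  have meas: "f \<in> borel_measurable F \<longleftrightarrow> f \<in> borel_measurable G" for f :: "'a \<Rightarrow> real"
    by (simp add: measurable_cong_sets[OF sets_eq refl])
  have RN_F: "AE x in F. RN_deriv G F x = ennreal (D x)"
    using absolutely_continuous_AE[OF _ ac RN] sets_eq by simp
  have l_eq: "AE x in F. ?l x = ln (D x)"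
    using RN_F by eventually_elim (simp add: entropy_density_def D_nn log_ln[symmetric])
  have l_meas: "?l \<in> borel_measurable F" by (simp add: meas)
  have "(\<integral>\<^sup>+x. ennreal (w x / D x) \<partial>F) = (\<integral>\<^sup>+x. RN_deriv G F x * ennreal (w x / D x) \<partial>G)"
    by (rule G.RN_deriv_nn_integral[OF ac sets_eq]) simp
  \<comment> \<open>Only an inequality: where \<open>D\<close> vanishes, the left integrand is 0
    whatever \<open>w\<close> is.\<close>
  also have "\<dots> \<le> (\<integral>\<^sup>+x. ennreal (w x) \<partial>G)"
  proof (rule nn_integral_mono_AE)
    show "AE x in G. RN_deriv G F x * ennreal (w x / D x) \<le> ennreal (w x)"
      using RN
    proof eventually_elim
      case (elim x)
      then show ?case
        using D_nn[of x] by (cases "D x = 0") (simp_all add: ennreal_mult'[symmetric])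
    qed
  qed
  also note le1
  finally have le: "(\<integral>\<^sup>+x. ennreal (w x / D x) \<partial>F) \<le> 1" .
  have q_nn: "AE x in F. 0 \<le> w x / D x"
    using pos D_pos by eventually_elim simp
  have q_meas: "(\<lambda>x. w x / D x) \<in> borel_measurable F" by (simp add: meas)
  have q_int: "integrable F (\<lambda>x. w x / D x)"
    using le by (intro integrableI_nonneg q_meas q_nn) (auto simp: less_top[symmetric] top_unique)
  have q_le: "(\<integral>x. w x / D x \<partial>F) \<le> 1"
    using le by (subst (asm) nn_integral_eq_integral[OF q_int q_nn]) simp
  have key: "AE x in F. ln (w x) - ?l x \<le> w x / D x - 1"
    using pos D_pos l_eq
  proof eventually_elim
    case (elim x)
    then show ?case using ln_le_minus_one[of "w x / D x"] by (simp add: ln_div)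
  qed
  \<comment> \<open>The positive part of \<open>?l\<close> has finite integral by the case
    assumption, and \<open>key\<close> bounds the negative part; only then can the pointwise
    inequality be integrated.\<close>
  have "(\<integral>\<^sup>+x. ennreal (- ?l x) \<partial>F) \<le> (\<integral>\<^sup>+x. ennreal \<bar>w x / D x - ln (w x)\<bar> \<partial>F)"
  proof (rule nn_integral_mono_AE)
    show "AE x in F. ennreal (- ?l x) \<le> ennreal \<bar>w x / D x - ln (w x)\<bar>"
      using key by eventually_elim (auto intro!: ennreal_leI)
  qed
  also have "\<dots> < \<infinity>"
    using integrable_abs[OF Bochner_Integration.integrable_diff[OF q_int int_ln]]
    by (simp add: real_integrable_def less_top)
  finally have l_int: "integrable F ?l"
    using True l_meas by (auto simp: real_integrable_def)
  have "(\<integral>x. ln (w x) - ?l x \<partial>F) \<le> (\<integral>x. w x / D x - 1 \<partial>F)"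
    using key int_ln l_int q_int by (intro integral_mono_AE) auto
  then have "(\<integral>x. ln (w x) \<partial>F) \<le> (\<integral>x. ?l x \<partial>F)"
    using int_ln l_int q_int q_le by (simp add: F.prob_space)
  then show ?thesis
    using ac l_int by (simp add: KL_div_def ext_expectation_eq_integral)
qed

text \<open>By uniqueness of Radon-Nikodym derivatives, \<open>w\<close> agrees with
  \<open>RN_deriv G F\<close> almost everywhere for \<open>G\<close>, and absolute continuity
  carries this over to \<open>F\<close>.\<close>

lemma KL_div_eq_integral_ln:
  fixes w :: "'a \<Rightarrow> real"
  assumes G: "finite_measure G" and w[measurable]: "w \<in> borel_measurable G"
    and F: "F = density G (\<lambda>x. ennreal (w x))"
    and pos: "AE x in F. 0 \<le> w x" and int: "integrable F (\<lambda>x. ln (w x))"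
  shows "KL_div F G = ereal (\<integral>x. ln (w x) \<partial>F)"
proof -
  interpret G: finite_measure G by fact
  have ac: "absolutely_continuous G F"
    unfolding F by (rule absolutely_continuousI_density) simp
  have "AE x in G. ennreal (w x) = RN_deriv G F x"
    using F by (intro G.RN_deriv_unique) auto
  then have "AE x in F. ennreal (w x) = RN_deriv G F x"
    using absolutely_continuous_AE[OF _ ac] F by simp
  then have eq: "AE x in F. entropy_density (exp 1) G F x = ln (w x)"
    using pos
  proof eventually_elim
    case (elim x)
    then show ?case by (simp add: entropy_density_def log_ln[symmetric] flip: elim(1))
  qed
  have meas: "entropy_density (exp 1) G F \<in> borel_measurable F" "(\<lambda>x. ln (w x)) \<in> borel_measurable F"
    unfolding F by auto
  have "integrable F (entropy_density (exp 1) G F)"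
    using int integrable_cong_AE[OF meas eq] by simp
  then show ?thesis
    using ac integral_cong_AE[OF meas eq]
    by (simp add: KL_div_def ext_expectation_eq_integral)
qed

section \<open>Integration on the unit interval, and the tilting functions of the dual
  problem\<close>

lemma unit_distrs_prob_space: "F \<in> unit_distrs \<Longrightarrow> prob_space F"
  and unit_distrs_sets: "F \<in> unit_distrs \<Longrightarrow> sets F = sets borel"
  by (auto simp: unit_distrs_def)

lemma unit_distrs_AE:
  assumes "F \<in> unit_distrs"
  shows "AE x in F. x \<in> {0..1}"
proof -
  interpret prob_space F using assms by (rule unit_distrs_prob_space)
  show ?thesis
    using assms by (subst prob_eq_1[symmetric, unfolded emeasure_eq_measure])
      (auto simp: unit_distrs_def emeasure_eq_measure)
qed

lemma unit_distrs_measurable: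
  "F \<in> unit_distrs \<Longrightarrow> f \<in> borel_measurable F \<longleftrightarrow> f \<in> borel_measurable borel"
  by (simp add: measurable_cong_sets[OF unit_distrs_sets refl])

lemma unit_distrs_integrable:
  fixes f :: "real \<Rightarrow> real"
  assumes F: "F \<in> unit_distrs" and f: "f \<in> borel_measurable borel"
    and B: "\<And>x. x \<in> {0..1} \<Longrightarrow> \<bar>f x\<bar> \<le> B"
  shows "integrable F f"
proof -
  interpret prob_space F using F by (rule unit_distrs_prob_space)
  show ?thesis
  proof (rule integrable_const_bound)
    show "AE x in F. norm (f x) \<le> B"
      using unit_distrs_AE[OF F] by eventually_elim (simp add: B)
  qed (simp add: F f unit_distrs_measurable)
qed

lemma unit_distrs_integrable_power: "F \<in> unit_distrs \<Longrightarrow> integrable F (\<lambda>x. x ^ k)"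
  by (rule unit_distrs_integrable[where B = 1]) (auto simp: power_le_one power_abs)

lemma unit_distrs_integrable_id: "F \<in> unit_distrs \<Longrightarrow> integrable F (\<lambda>x. x)"
  using unit_distrs_integrable_power[of F 1] by simp

text \<open>The function whose logarithm is averaged in the dual problem; at \<open>\<nu> = 1 / (1 - \<mu>)\<close> it
  vanishes at the right end point \<open>1\<close>.\<close>

definition tilt :: "real \<Rightarrow> real \<Rightarrow> real \<Rightarrow> real" where
  "tilt \<mu> \<nu> x = 1 - (x - \<mu>) * \<nu>"

lemma tilt_measurable[measurable]: "tilt \<mu> \<nu> \<in> borel_measurable borel"
  unfolding tilt_def by measurable

lemma tilt_ge:
  assumes "0 \<le> \<nu>" "x \<le> 1"
  shows "1 - (1 - \<mu>) * \<nu> \<le> tilt \<mu> \<nu> x"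
  using assms by (auto simp: tilt_def intro!: mult_right_mono)

lemma tilt_le:
  assumes "0 \<le> \<nu>" "0 \<le> x" "\<mu> \<le> 1"
  shows "tilt \<mu> \<nu> x \<le> 1 + \<nu>"
proof -
  have "(\<mu> - x) * \<nu> \<le> 1 * \<nu>" using assms by (intro mult_right_mono) auto
  then show ?thesis by (simp add: tilt_def algebra_simps)
qed

lemma tilt_pos:
  assumes "0 \<le> \<nu>" "(1 - \<mu>) * \<nu> < 1" "x \<le> 1"
  shows "0 < tilt \<mu> \<nu> x"
  using tilt_ge[of \<nu> x \<mu>] assms by simp

lemma integral_tilt:
  assumes "F \<in> unit_distrs"
  shows "integrable F (tilt \<mu> \<nu>)" "(\<integral>x. tilt \<mu> \<nu> x \<partial>F) = 1 - ((\<integral>x. x \<partial>F) - \<mu>) * \<nu>"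
proof -
  interpret prob_space F using assms by (rule unit_distrs_prob_space)
  note [simp] = unit_distrs_integrable_id[OF assms]
  show "integrable F (tilt \<mu> \<nu>)" unfolding tilt_def by simp
  show "(\<integral>x. tilt \<mu> \<nu> x \<partial>F) = 1 - ((\<integral>x. x \<partial>F) - \<mu>) * \<nu>"
    unfolding tilt_def by (simp add: prob_space)
qed

lemma integrable_ln_tilt:
  assumes F: "F \<in> unit_distrs" and "0 \<le> \<nu>" "(1 - \<mu>) * \<nu> < 1" "\<mu> \<le> 1"
  shows "integrable F (\<lambda>x. ln (tilt \<mu> \<nu> x))"
proof (rule unit_distrs_integrable[OF F])
  let ?B = "\<bar>ln (1 - (1 - \<mu>) * \<nu>)\<bar> + \<bar>ln (1 + \<nu>)\<bar>"
  fix x :: real assume x: "x \<in> {0..1}"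
  have "ln (1 - (1 - \<mu>) * \<nu>) \<le> ln (tilt \<mu> \<nu> x)"
    using tilt_ge[of \<nu> x \<mu>] assms x by (intro ln_mono) auto
  moreover have "ln (tilt \<mu> \<nu> x) \<le> ln (1 + \<nu>)"
    using tilt_le[of \<nu> x \<mu>] tilt_pos[of \<nu> \<mu> x] assms x by (intro ln_mono) auto
  ultimately show "\<bar>ln (tilt \<mu> \<nu> x)\<bar> \<le> ?B" by linarith
qed measurable

section \<open>Weak duality and attainment\<close>

text \<open>A mean of at least \<open>\<mu>\<close> makes the \<open>G\<close>-integral of the tilt
  at most 1, so the tilt is admissible as \<open>w\<close> in
  \<open>KL_div_ge_integral_ln\<close>.\<close>

lemma D_min_ge_integral_ln_tilt:
  assumes F: "F \<in> unit_distrs" and \<nu>: "0 \<le> \<nu>" "(1 - \<mu>) * \<nu> < 1" and \<mu>: "\<mu> \<le> 1"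
  shows "ereal (\<integral>x. ln (tilt \<mu> \<nu> x) \<partial>F) \<le> D_min F \<mu>"
  unfolding D_min_def
proof (rule INF_greatest)
  fix G assume "G \<in> {G \<in> unit_distrs. (\<integral>x. x \<partial>G) \<ge> \<mu>}"
  then have G: "G \<in> unit_distrs" and mean: "(\<integral>x. x \<partial>G) \<ge> \<mu>" by auto
  interpret F: prob_space F using F by (rule unit_distrs_prob_space)
  interpret G: prob_space G using G by (rule unit_distrs_prob_space)
  have AE_pos: "AE x in H. 0 < tilt \<mu> \<nu> x" if "H \<in> unit_distrs" for H
    using unit_distrs_AE[OF that] by eventually_elim (simp add: tilt_pos \<nu>)
  have "AE x in G. 0 \<le> tilt \<mu> \<nu> x"
    using AE_pos[OF G] by eventually_elim simp
  then have "(\<integral>\<^sup>+x. ennreal (tilt \<mu> \<nu> x) \<partial>G) = ennreal (\<integral>x. tilt \<mu> \<nu> x \<partial>G)"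
    by (rule nn_integral_eq_integral[OF integral_tilt(1)[OF G]])
  also have "\<dots> \<le> 1"
    using mean \<nu> by (simp add: integral_tilt[OF G])
  finally show "ereal (\<integral>x. ln (tilt \<mu> \<nu> x) \<partial>F) \<le> KL_div F G"
    using F G \<nu> \<mu> AE_pos[OF F]
    by (intro KL_div_ge_integral_ln F.prob_space_axioms G.finite_measure_axioms integrable_ln_tilt)
       (auto simp: unit_distrs_measurable unit_distrs_sets)
qed

text \<open>The optimal \<open>G\<close> is \<open>F\<close> weighted by
  \<open>1 / tilt \<mu> \<nu>\<close>, plus the missing mass at \<open>1\<close>. The assumption
  \<open>slack\<close> is complementary slackness: the atom either has mass 0 or sits where the tilt
  is 0, so weighting \<open>G\<close> by the tilt returns \<open>F\<close>.\<close>

lemma D_min_le_integral_ln_tilt: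
  fixes F :: "real measure"
  assumes F: "F \<in> unit_distrs" and \<nu>: "0 < \<nu>" "(1 - \<mu>) * \<nu> \<le> 1"
    and pos: "AE x in F. 0 < tilt \<mu> \<nu> x"
    and le1: "(\<integral>\<^sup>+x. ennreal (1 / tilt \<mu> \<nu> x) \<partial>F) \<le> 1"
    and slack: "(\<integral>\<^sup>+x. ennreal (1 / tilt \<mu> \<nu> x) \<partial>F) = 1 \<or> tilt \<mu> \<nu> 1 = 0"
  shows "integrable F (\<lambda>x. ln (tilt \<mu> \<nu> x))"
    and "D_min F \<mu> \<le> ereal (\<integral>x. ln (tilt \<mu> \<nu> x) \<partial>F)"
proof -
  let ?w = "tilt \<mu> \<nu>"
  define a where "a = (\<integral>\<^sup>+x. ennreal (1 / ?w x) \<partial>F)"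
  interpret F: prob_space F using F by (rule unit_distrs_prob_space)
  note [simp] = unit_distrs_measurable[OF F]
  have sp: "space F = UNIV"
    using sets_eq_imp_space_eq[OF unit_distrs_sets[OF F]] by simp
  have inv_nn: "AE x in F. 0 \<le> 1 / ?w x"
    using pos by eventually_elim simp
  have inv_int: "integrable F (\<lambda>x. 1 / ?w x)"
    using le1 inv_nn by (intro integrableI_nonneg) (auto simp: less_top[symmetric] top_unique)
  show ln_int: "integrable F (\<lambda>x. ln (?w x))"
  \<comment> \<open>The bound comes from \<open>ln y \<le> y - 1\<close>, used at the tilt and at
    its reciprocal.\<close>
  proof (rule Bochner_Integration.integrable_bound[where f = "\<lambda>x. ?w x + 1 / ?w x"])
    show "integrable F (\<lambda>x. ?w x + 1 / ?w x)"
      by (intro Bochner_Integration.integrable_add inv_int integral_tilt(1) F)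
    show "AE x in F. norm (ln (?w x)) \<le> norm (?w x + 1 / ?w x)"
      using pos
    proof eventually_elim
      case (elim x)
      have "0 < 1 / ?w x" using elim by simp
      then have "- ln (?w x) \<le> 1 / ?w x - 1"
        using ln_le_minus_one[of "1 / ?w x"] elim by (simp add: ln_div)
      then have "\<bar>ln (?w x)\<bar> \<le> ?w x + 1 / ?w x"
        using ln_le_minus_one[OF elim] elim \<open>0 < 1 / ?w x\<close> by linarith
      then show ?case by simp
    qed
  qed simp
  define K where "K = density F (\<lambda>x. ennreal (1 / ?w x))"
  have sets_K: "sets K = sets F" by (simp add: K_def)
  obtain G where sets_G: "sets G = sets K"
    and G: "\<And>f :: real \<Rightarrow> ennreal. f \<in> borel_measurable K \<Longrightarrow>
      (\<integral>\<^sup>+x. f x \<partial>G) = (\<integral>\<^sup>+x. f x \<partial>K) + (1 - a) * f 1"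
    using obtain_measure_add_atom[of 1 K "1 - a"] by (auto simp: K_def sp)
  have meas_G: "f \<in> borel_measurable G \<longleftrightarrow> f \<in> borel_measurable borel" for f :: "real \<Rightarrow> 'b :: topological_space"
    using F by (simp add: sets_G sets_K unit_distrs_sets cong: measurable_cong_sets)
  have int_G: "(\<integral>\<^sup>+x. f x \<partial>G) = (\<integral>\<^sup>+x. ennreal (1 / ?w x) * f x \<partial>F) + (1 - a) * f 1"
    if [measurable]: "f \<in> borel_measurable borel" for f :: "real \<Rightarrow> ennreal"
    by (subst G) (simp_all add: K_def nn_integral_density)
  have sets_G_borel: "sets G = sets borel"
    using F by (simp add: sets_G sets_K unit_distrs_sets)
  have sp_G: "space G = UNIV"
    using sets_eq_imp_space_eq[OF sets_G_borel] by simp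
  \<comment> \<open>Subtraction in \<open>ennreal\<close> is truncated, so the total mass of
    \<open>G\<close> is 1 only thanks to \<open>a \<le> 1\<close>.\<close>
  have a1: "a + (1 - a) = 1"
    using le1 unfolding a_def by simp
  have em_G: "emeasure G A = (\<integral>\<^sup>+x. ennreal (1 / ?w x) * indicator A x \<partial>F) + (1 - a) * indicator A 1"
    if "A \<in> sets borel" for A
    using int_G[of "indicator A"] that by (simp add: sets_G_borel)
  have G_UNIV: "emeasure G UNIV = 1"
    using a1 by (simp add: em_G a_def)
  have "emeasure G {0..1} = (\<integral>\<^sup>+x. ennreal (1 / ?w x) \<partial>F) + (1 - a)"
  proof -
    have "(\<integral>\<^sup>+x. ennreal (1 / ?w x) * indicator {0..1} x \<partial>F) = (\<integral>\<^sup>+x. ennreal (1 / ?w x) \<partial>F)"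
      using unit_distrs_AE[OF F] by (intro nn_integral_cong_AE) (auto simp: indicator_def)
    then show ?thesis by (simp add: em_G)
  qed
  then have G_unit: "G \<in> unit_distrs"
    using a1 G_UNIV by (auto simp: unit_distrs_def a_def sets_G_borel sp_G intro!: prob_spaceI)
  interpret G: prob_space G using G_unit by (rule unit_distrs_prob_space)
  have slack': "(1 - a) * ennreal (?w 1) = 0"
    using slack unfolding a_def by auto
  have F_eq: "F = density G (\<lambda>x. ennreal (?w x))"
  proof (rule measure_eqI)
    fix A assume "A \<in> sets F"
    then have A[measurable]: "A \<in> sets borel" using F by (simp add: unit_distrs_sets)
    have "emeasure (density G (\<lambda>x. ennreal (?w x))) A = (\<integral>\<^sup>+x. ennreal (?w x) * indicator A x \<partial>G)"
      by (rule emeasure_density) (simp_all add: meas_G sets_G_borel A)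
    also have "\<dots> = (\<integral>\<^sup>+x. ennreal (1 / ?w x) * (ennreal (?w x) * indicator A x) \<partial>F)
        + (1 - a) * ennreal (?w 1) * indicator A 1"
      by (simp add: int_G mult.assoc)
    also have "(\<integral>\<^sup>+x. ennreal (1 / ?w x) * (ennreal (?w x) * indicator A x) \<partial>F) = (\<integral>\<^sup>+x. indicator A x \<partial>F)"
    proof (rule nn_integral_cong_AE)
      show "AE x in F. ennreal (1 / ?w x) * (ennreal (?w x) * indicator A x) = indicator A x"
        using pos
      proof eventually_elim
        case (elim x)
        have "ennreal (1 / ?w x) * ennreal (?w x) = 1"
          using elim by (simp add: ennreal_mult'[symmetric])
        then show ?case by (simp add: mult.assoc[symmetric])
      qed
    qed
    finally show "emeasure F A = emeasure (density G (\<lambda>x. ennreal (?w x))) A"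
      using slack' F by (simp add: unit_distrs_sets)
  qed (use F in \<open>simp add: unit_distrs_sets sets_G_borel\<close>)
  have "KL_div F G = ereal (\<integral>x. ln (?w x) \<partial>F)"
    using pos by (intro KL_div_eq_integral_ln G.finite_measure_axioms F_eq ln_int)
      (auto simp: meas_G)
  \<comment> \<open>The constraint is tight: the \<open>G\<close>-integral of the tilt is the mass
    of \<open>F\<close>, that is 1, and \<open>\<nu> > 0\<close> then forces the mean to be
    \<open>\<mu>\<close>.\<close>
  moreover have "(\<integral>x. x \<partial>G) = \<mu>"
  proof -
    have w_nn: "AE x in G. 0 \<le> ?w x"
      using unit_distrs_AE[OF G_unit]
    proof eventually_elim
      case (elim x)
      then show ?case using tilt_ge[of \<nu> x \<mu>] \<nu> by simp
    qed
    have "ennreal (\<integral>x. ?w x \<partial>G) = (\<integral>\<^sup>+x. ennreal (?w x) \<partial>G)"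
      by (rule nn_integral_eq_integral[symmetric, OF integral_tilt(1)[OF G_unit] w_nn])
    also have "\<dots> = emeasure (density G (\<lambda>x. ennreal (?w x))) UNIV"
      by (subst emeasure_density) (simp_all add: meas_G sets_G_borel)
    also have "\<dots> = 1"
      using F.emeasure_space_1 by (simp add: F_eq[symmetric] sp)
    finally have "(\<integral>x. ?w x \<partial>G) = 1" by simp
    then show ?thesis using \<nu> by (simp add: integral_tilt[OF G_unit])
  qed
  ultimately show "D_min F \<mu> \<le> ereal (\<integral>x. ln (?w x) \<partial>F)"
    unfolding D_min_def using G_unit by (intro INF_lower2[of G]) auto
qed

section \<open>Strong duality\<close>

text \<open>The tilt is affine in its parameter, so \<open>tilt \<mu> (t * \<nu>) x\<close> is a
  convex combination of \<open>1\<close> and \<open>tilt \<mu> \<nu> x\<close>; moreover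
  \<open>ln 1 = 0\<close>.\<close>

lemma ln_tilt_concave:
  assumes "0 \<le> t" "t \<le> 1" and pos: "0 < tilt \<mu> \<nu> x"
  shows "t * ln (tilt \<mu> \<nu> x) \<le> ln (tilt \<mu> (t * \<nu>) x)"
proof -
  have "(1 - t) * ln 1 + t * ln (tilt \<mu> \<nu> x) \<le> ln ((1 - t) *\<^sub>R 1 + t *\<^sub>R tilt \<mu> \<nu> x)"
    using assms by (intro concave_onD[OF ln_concave]) auto
  also have "(1 - t) *\<^sub>R 1 + t *\<^sub>R tilt \<mu> \<nu> x = tilt \<mu> (t * \<nu>) x"
    by (simp add: tilt_def algebra_simps)
  finally show ?thesis by simp
qed

lemma integrable_inverse_tilt:
  assumes F: "F \<in> unit_distrs" and \<nu>: "0 \<le> \<nu>" "(1 - \<mu>) * \<nu> < 1"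
  shows "integrable F (\<lambda>x. 1 / tilt \<mu> \<nu> x)"
proof (rule unit_distrs_integrable[OF F])
  fix x :: real assume x: "x \<in> {0..1}"
  show "\<bar>1 / tilt \<mu> \<nu> x\<bar> \<le> 1 / (1 - (1 - \<mu>) * \<nu>)"
    using tilt_ge[of \<nu> x \<mu>] tilt_pos[of \<nu> \<mu> x] \<nu> x by (auto intro!: divide_left_mono)
qed measurable

lemma nn_integral_inverse_tilt:
  assumes F: "F \<in> unit_distrs" and \<nu>: "0 \<le> \<nu>" "(1 - \<mu>) * \<nu> < 1"
  shows "(\<integral>\<^sup>+x. ennreal (1 / tilt \<mu> \<nu> x) \<partial>F) = ennreal (\<integral>x. 1 / tilt \<mu> \<nu> x \<partial>F)"
proof (rule nn_integral_eq_integral[OF integrable_inverse_tilt[OF assms]])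
  show "AE x in F. 0 \<le> 1 / tilt \<mu> \<nu> x"
    using unit_distrs_AE[OF F]
  proof eventually_elim
    case (elim x)
    then show ?case using tilt_pos[of \<nu> \<mu> x] \<nu> by simp
  qed
qed

text \<open>Prepares an intermediate value argument. For parameters up to \<open>b\<close> all tilts
  are at least \<open>?\<delta> > 0\<close>, so the integrand is Lipschitz in \<open>\<nu>\<close>
  with a constant independent of \<open>x\<close>.\<close>

lemma continuous_on_integral_inverse_tilt:
  assumes F: "F \<in> unit_distrs" and \<mu>: "0 \<le> \<mu>" "\<mu> \<le> 1" and b: "(1 - \<mu>) * b < 1"
  shows "continuous_on {0..b} (\<lambda>\<nu>. \<integral>x. 1 / tilt \<mu> \<nu> x \<partial>F)"
proof -
  interpret F: prob_space F using F by (rule unit_distrs_prob_space)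
  let ?\<delta> = "1 - (1 - \<mu>) * b"
  have adm: "0 \<le> \<nu>" "(1 - \<mu>) * \<nu> < 1" "?\<delta> \<le> 1 - (1 - \<mu>) * \<nu>" if "\<nu> \<in> {0..b}" for \<nu>
  proof -
    have "(1 - \<mu>) * \<nu> \<le> (1 - \<mu>) * b"
      using that \<mu> by (intro mult_left_mono) auto
    then show "(1 - \<mu>) * \<nu> < 1" "?\<delta> \<le> 1 - (1 - \<mu>) * \<nu>" using b by auto
  qed (use that in simp)
  have "(1 / ?\<delta>\<^sup>2)-lipschitz_on {0..b} (\<lambda>\<nu>. \<integral>x. 1 / tilt \<mu> \<nu> x \<partial>F)"
  proof (rule lipschitz_onI)
    fix s t assume s: "s \<in> {0..b}" and t: "t \<in> {0..b}"
    let ?f = "\<lambda>x. 1 / tilt \<mu> s x - 1 / tilt \<mu> t x"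
    note int = integrable_inverse_tilt[OF F adm(1,2)[OF s]] integrable_inverse_tilt[OF F adm(1,2)[OF t]]
    have "\<bar>\<integral>x. ?f x \<partial>F\<bar> \<le> (\<integral>x. \<bar>?f x\<bar> \<partial>F)"
      by (rule integral_abs_bound)
    also have "\<dots> \<le> (\<integral>x. 1 / ?\<delta>\<^sup>2 * \<bar>s - t\<bar> \<partial>F)"
    proof (rule integral_mono_AE)
      show "AE x in F. \<bar>?f x\<bar> \<le> 1 / ?\<delta>\<^sup>2 * \<bar>s - t\<bar>"
        using unit_distrs_AE[OF F]
      proof eventually_elim
        case (elim x)
        have ge: "?\<delta> \<le> tilt \<mu> s x" "?\<delta> \<le> tilt \<mu> t x"
          using tilt_ge[of s x \<mu>] tilt_ge[of t x \<mu>] adm[OF s] adm[OF t] elim by auto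
        have pos: "0 < ?\<delta>" using b by simp
        have "?f x = (x - \<mu>) * (s - t) / (tilt \<mu> s x * tilt \<mu> t x)"
          using ge pos by (simp add: divide_simps) (simp add: tilt_def algebra_simps)
        then have "\<bar>?f x\<bar> = \<bar>x - \<mu>\<bar> * \<bar>s - t\<bar> / (tilt \<mu> s x * tilt \<mu> t x)"
          using ge pos by (simp add: abs_mult)
        also have "\<dots> \<le> 1 * \<bar>s - t\<bar> / (?\<delta> * ?\<delta>)"
          using ge pos elim \<mu> by (intro frac_le mult_mono) (auto simp: abs_le_iff)
        finally show ?case by (simp add: power2_eq_square)
      qed
    qed (use int in auto)
    finally show "dist (\<integral>x. 1 / tilt \<mu> s x \<partial>F) (\<integral>x. 1 / tilt \<mu> t x \<partial>F) \<le> 1 / ?\<delta>\<^sup>2 * dist s t"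
      using int by (simp add: dist_real_def F.prob_space)
  qed simp
  then show ?thesis by (rule lipschitz_on_continuous_on)
qed

lemma D_min_le_0:
  assumes F: "F \<in> unit_distrs" and "\<mu> \<le> (\<integral>x. x \<partial>F)"
  shows "D_min F \<mu> \<le> 0"
proof -
  interpret F: prob_space F using F by (rule unit_distrs_prob_space)
  have "KL_div F F = ereal (\<integral>x. ln 1 \<partial>F)"
    by (rule KL_div_eq_integral_ln) (simp_all add: F.finite_measure_axioms density_1)
  then show ?thesis
    unfolding D_min_def using assms by (intro INF_lower2[of F]) auto
qed

text \<open>The end point \<open>1 / (1 - \<mu>)\<close> is left out since the tilt vanishes there
  at \<open>1\<close>; when the minimiser belongs to it, its dual value is approached from
  inside.\<close>

lemma D_min_le_dual:
  assumes F: "F \<in> unit_distrs" and \<mu>: "0 \<le> \<mu>" "\<mu> < 1"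
  shows "D_min F \<mu> \<le> (SUP \<nu>\<in>{0..<1 / (1 - \<mu>)}. ereal (\<integral>x. ln (tilt \<mu> \<nu> x) \<partial>F))"
    (is "_ \<le> ?S")
proof (cases "\<mu> \<le> (\<integral>x. x \<partial>F)")
  case True
  have "ereal (\<integral>x. ln (tilt \<mu> 0 x) \<partial>F) \<le> ?S"
    using \<mu> by (intro SUP_upper) auto
  then show ?thesis using D_min_le_0[OF F True] by (simp add: tilt_def zero_ereal_def[symmetric])
next
  case False
  interpret F: prob_space F using F by (rule unit_distrs_prob_space)
  define N where "N = 1 / (1 - \<mu>)"
  define m where "m = (\<integral>x. x \<partial>F)"
  define \<phi> where "\<phi> \<nu> = (\<integral>x. 1 / tilt \<mu> \<nu> x \<partial>F)" for \<nu>
  have m: "m < \<mu>" using False by (simp add: m_def)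
  have N: "0 < N" "(1 - \<mu>) * N = 1" using \<mu> by (auto simp: N_def)
  have adm: "(1 - \<mu>) * \<nu> < 1" if "\<nu> < N" for \<nu>
    using that \<mu> by (simp add: N_def field_simps)
  show ?thesis
  proof (cases "\<exists>b. 0 \<le> b \<and> b < N \<and> 1 < \<phi> b")
    \<comment> \<open>The parameter 0 has \<open>\<phi> 0 = 1\<close>, but a positive one is wanted.
      As \<open>\<phi>\<close> has slope \<open>m - \<mu> < 0\<close> at 0, some small
      \<open>a > 0\<close> has \<open>\<phi> a \<le> 1\<close>, and the value 1 is taken between
      \<open>a\<close> and \<open>b\<close>.\<close>
    case True
    then obtain b where b: "0 \<le> b" "b < N" "1 < \<phi> b" by blast
    have "\<phi> 0 = 1" by (simp add: \<phi>_def tilt_def F.prob_space)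
    with b have "0 < b" by (cases "b = 0") auto
    \<comment> \<open>The three bounds give \<open>a < b\<close>, the estimate
      \<open>1 / (1 - t) \<le> 1 + t + 2 * a\<^sup>2\<close> for \<open>|t| \<le> a\<close>, and
      \<open>2 * a\<^sup>2 \<le> (\<mu> - m) * a\<close>.\<close>
    define a where "a = Min {b / 2, 1 / 2, (\<mu> - m) / 4}"
    have a: "0 < a" "a < b" "a \<le> 1 / 2" "4 * a \<le> \<mu> - m"
      using \<open>0 < b\<close> m by (auto simp: a_def min_def)
    have "\<phi> a \<le> (\<integral>x. 1 + (x - \<mu>) * a + 2 * a\<^sup>2 \<partial>F)"
      unfolding \<phi>_def
    proof (rule integral_mono_AE)
      show "integrable F (\<lambda>x. 1 / tilt \<mu> a x)"
        using a b by (intro integrable_inverse_tilt F adm) auto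
      show "integrable F (\<lambda>x. 1 + (x - \<mu>) * a + 2 * a\<^sup>2)"
        using unit_distrs_integrable_id[OF F] by auto
      show "AE x in F. 1 / tilt \<mu> a x \<le> 1 + (x - \<mu>) * a + 2 * a\<^sup>2"
        using unit_distrs_AE[OF F]
      proof eventually_elim
        case (elim x)
        define t where "t = (x - \<mu>) * a"
        have "\<bar>x - \<mu>\<bar> * a \<le> 1 * a"
          using elim \<mu> a by (intro mult_right_mono) (auto simp: abs_le_iff)
        then have t: "\<bar>t\<bar> \<le> a" using a by (simp add: t_def abs_mult)
        \<comment> \<open>The product reached below equals
          \<open>1 - t\<^sup>2 + 2 * a\<^sup>2 * (1 - t)\<close>, where
          \<open>1 - t \<ge> 1 / 2\<close>.\<close>
        then have "t\<^sup>2 \<le> a\<^sup>2" by (metis abs_ge_zero power2_abs power_mono)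
        also have "a\<^sup>2 * 1 \<le> a\<^sup>2 * (2 * (1 - t))"
          using t a by (intro mult_left_mono) auto
        finally have "1 \<le> (1 + t + 2 * a\<^sup>2) * (1 - t)"
          by (simp add: algebra_simps power2_eq_square)
        then have "1 / (1 - t) \<le> 1 + t + 2 * a\<^sup>2"
          using t a by (simp add: divide_le_eq)
        then show ?case by (simp add: tilt_def t_def)
      qed
    qed
    also have "\<dots> = 1 - (\<mu> - m) * a + 2 * a\<^sup>2"
      using unit_distrs_integrable_id[OF F] by (simp add: F.prob_space m_def algebra_simps)
    also have "\<dots> \<le> 1"
      using mult_right_mono[OF a(4), of a] a by (simp add: power2_eq_square)
    finally have "\<phi> a \<le> 1" .
    moreover have "continuous_on {a..b} \<phi>"
      using continuous_on_integral_inverse_tilt[OF F _ _ adm[OF b(2)]] \<mu> a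
      unfolding \<phi>_def by (auto intro: continuous_on_subset)
    ultimately obtain \<nu> where \<nu>: "a \<le> \<nu>" "\<nu> \<le> b" "\<phi> \<nu> = 1"
      using IVT'[of \<phi> a 1 b] a b by auto
    have \<nu>': "0 < \<nu>" "\<nu> < N" "(1 - \<mu>) * \<nu> < 1"
      using \<nu> a b adm[of \<nu>] by auto
    have "AE x in F. 0 < tilt \<mu> \<nu> x"
      using unit_distrs_AE[OF F] by eventually_elim (use \<nu>' in \<open>auto intro!: tilt_pos\<close>)
    moreover have "(\<integral>\<^sup>+x. ennreal (1 / tilt \<mu> \<nu> x) \<partial>F) = 1"
      using nn_integral_inverse_tilt[OF F, of \<nu> \<mu>] \<nu>' \<nu>(3) by (simp add: \<phi>_def)
    ultimately have "D_min F \<mu> \<le> ereal (\<integral>x. ln (tilt \<mu> \<nu> x) \<partial>F)"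
      using \<nu>' by (intro D_min_le_integral_ln_tilt F) auto
    also have "\<dots> \<le> ?S"
      using \<nu>' by (intro SUP_upper) (auto simp: N_def)
    finally show ?thesis .
  next
    case False
    \<comment> \<open>Now \<open>\<phi> \<le> 1\<close> on all of \<open>[0, N)\<close>. The
      parameters \<open>t n * N\<close> lie strictly inside and tend to \<open>N\<close>; the shift
      by 2 keeps \<open>t 0\<close> positive.\<close>
    define t where "t n = 1 - 1 / real (n + 2)" for n
    have t: "0 < t n" "t n < 1" for n by (auto simp: t_def)
    have t_lim: "t \<longlonglongrightarrow> 1"
      unfolding t_def by real_asymp
    \<comment> \<open>The inverse in \<open>ennreal\<close> is infinite where the tilt vanishes, and
      continuous there; real division would give 0.\<close>
    define u where "u \<nu> x = inverse (ennreal (tilt \<mu> \<nu> x))" for \<nu> x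
    have u_meas: "u \<nu> \<in> borel_measurable F" for \<nu>
      unfolding u_def using F by (simp add: unit_distrs_measurable)
    have u_eq: "u \<nu> x = ennreal (1 / tilt \<mu> \<nu> x)" if "0 < tilt \<mu> \<nu> x" for \<nu> x
      using that by (simp add: u_def inverse_ennreal inverse_eq_divide)
    have u_le: "integral\<^sup>N F (u (t n * N)) \<le> 1" for n
    proof -
      have tN: "0 \<le> t n * N" "t n * N < N" using t[of n] N by auto
      have "integral\<^sup>N F (u (t n * N)) = (\<integral>\<^sup>+x. ennreal (1 / tilt \<mu> (t n * N) x) \<partial>F)"
        using unit_distrs_AE[OF F]
        by (intro nn_integral_cong_AE, eventually_elim)
           (use tN adm in \<open>auto intro!: u_eq tilt_pos\<close>)
      also have "\<dots> = ennreal (\<phi> (t n * N))"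
        using tN adm by (simp add: nn_integral_inverse_tilt[OF F] \<phi>_def)
      also have "\<dots> \<le> 1"
        using False tN by (auto simp: not_less)
      finally show ?thesis .
    qed
    have lim: "(\<lambda>n. u (t n * N) x) \<longlonglongrightarrow> u N x" for x
    proof -
      have "(\<lambda>n. ennreal (tilt \<mu> (t n * N) x)) \<longlonglongrightarrow> ennreal (tilt \<mu> (1 * N) x)"
        unfolding tilt_def by (intro tendsto_intros t_lim)
      from continuous_on_tendsto_compose[OF continuous_on_inverse_ennreal[OF continuous_on_id, of UNIV] this]
      show ?thesis by (simp add: u_def)
    qed
    \<comment> \<open>Fatou's lemma carries the bound to the boundary parameter
      \<open>N\<close>.\<close>
    have "integral\<^sup>N F (u N) = (\<integral>\<^sup>+x. liminf (\<lambda>n. u (t n * N) x) \<partial>F)"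
      by (intro nn_integral_cong lim_imp_Liminf[symmetric] lim) simp
    also have "\<dots> \<le> liminf (\<lambda>n. integral\<^sup>N F (u (t n * N)))"
      by (rule nn_integral_liminf[OF u_meas])
    also have "\<dots> \<le> liminf (\<lambda>n::nat. 1)"
      by (rule Liminf_mono) (simp add: u_le)
    also have "\<dots> = 1" by (simp add: Liminf_const)
    finally have uN: "integral\<^sup>N F (u N) \<le> 1" .
    \<comment> \<open>\<open>u N\<close> is infinite exactly where the tilt is not positive, so a
      finite integral excludes in particular an atom of \<open>F\<close> at
      \<open>1\<close>.\<close>
    then have "AE x in F. u N x \<noteq> \<infinity>"
      by (intro nn_integral_PInf_AE u_meas) (auto simp: top_unique)
    then have pos: "AE x in F. 0 < tilt \<mu> N x"
      by eventually_elim (auto simp: u_def not_less[symmetric] ennreal_eq_0_iff)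
    have "(\<integral>\<^sup>+x. ennreal (1 / tilt \<mu> N x) \<partial>F) = integral\<^sup>N F (u N)"
      using pos by (intro nn_integral_cong_AE, eventually_elim) (simp add: u_eq)
    \<comment> \<open>The second alternative of \<open>slack\<close> applies:
      \<open>(1 - \<mu>) * N = 1\<close> makes the tilt vanish at \<open>1\<close>.\<close>
    then have ln_int: "integrable F (\<lambda>x. ln (tilt \<mu> N x))"
      and D_le: "D_min F \<mu> \<le> ereal (\<integral>x. ln (tilt \<mu> N x) \<partial>F)"
      using D_min_le_integral_ln_tilt[OF F N(1) _ pos] uN N(2) by (auto simp: tilt_def)
    \<comment> \<open>Concavity compares the value at the excluded \<open>N\<close> with inner
      parameters at the cost of a factor \<open>t n\<close>, which tends to 1.\<close>
    have "ereal (t n * (\<integral>x. ln (tilt \<mu> N x) \<partial>F)) \<le> ?S" for n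
    proof -
      have tN: "0 \<le> t n * N" "t n * N < N" using t[of n] N by auto
      have "(\<integral>x. t n * ln (tilt \<mu> N x) \<partial>F) \<le> (\<integral>x. ln (tilt \<mu> (t n * N) x) \<partial>F)"
      proof (rule integral_mono_AE)
        show "integrable F (\<lambda>x. ln (tilt \<mu> (t n * N) x))"
          using tN adm \<mu> by (intro integrable_ln_tilt F) auto
        show "AE x in F. t n * ln (tilt \<mu> N x) \<le> ln (tilt \<mu> (t n * N) x)"
          using pos by eventually_elim (use t[of n] in \<open>auto intro!: ln_tilt_concave\<close>)
      qed (use ln_int in simp)
      then have "ereal (t n * (\<integral>x. ln (tilt \<mu> N x) \<partial>F)) \<le> ereal (\<integral>x. ln (tilt \<mu> (t n * N) x) \<partial>F)"
        by simp
      also have "\<dots> \<le> ?S"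
        using tN by (intro SUP_upper) (auto simp: N_def)
      finally show ?thesis .
    qed
    moreover have "(\<lambda>n. ereal (t n * (\<integral>x. ln (tilt \<mu> N x) \<partial>F))) \<longlonglongrightarrow> ereal (1 * (\<integral>x. ln (tilt \<mu> N x) \<partial>F))"
      by (intro tendsto_intros t_lim)
    ultimately have "ereal (1 * (\<integral>x. ln (tilt \<mu> N x) \<partial>F)) \<le> ?S"
      by (intro LIMSEQ_le_const2[OF _ exI[of _ 0]]) blast+
    then show ?thesis using D_le by simp
  qed
qed

section \<open>Approximating integrals from finitely many moments\<close>

lemma integral_diff_le_unit_distrs:
  fixes f g :: "real \<Rightarrow> real"
  assumes F: "F \<in> unit_distrs" and int: "integrable F f" "integrable F g"
    and le: "\<And>x. x \<in> {0..1} \<Longrightarrow> \<bar>f x - g x\<bar> \<le> e"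
  shows "\<bar>(\<integral>x. f x \<partial>F) - (\<integral>x. g x \<partial>F)\<bar> \<le> e"
proof -
  interpret F: prob_space F using F by (rule unit_distrs_prob_space)
  have "\<bar>\<integral>x. f x - g x \<partial>F\<bar> \<le> (\<integral>x. \<bar>f x - g x\<bar> \<partial>F)"
    by (rule integral_abs_bound)
  also have "\<dots> \<le> (\<integral>x. e \<partial>F)"
  proof (rule integral_mono_AE)
    show "AE x in F. \<bar>f x - g x\<bar> \<le> e"
      using unit_distrs_AE[OF F] by eventually_elim (rule le)
  qed (use int in auto)
  finally show ?thesis using int by (simp add: F.prob_space)
qed

lemma moments_eq_imp_integral_power_eq:
  assumes F: "F \<in> unit_distrs" and F': "F' \<in> distrs_with_moments d (moments d F)" and "k \<le> d"
  shows "(\<integral>x. x ^ k \<partial>F') = (\<integral>x. x ^ k \<partial>F)"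
\<comment> \<open>The list of moments starts at the first power; the zeroth moments agree because
  both total masses are 1.\<close>
proof (cases "k = 0")
  case True
  have "F' \<in> unit_distrs" using F' by (simp add: distrs_with_moments_def)
  then show ?thesis
    using True F by (simp add: prob_space.prob_space unit_distrs_prob_space)
next
  case False
  then have "k \<in> set [1..<d + 1]" using \<open>k \<le> d\<close> by auto
  moreover have "moments d F' = moments d F" using F' by (simp add: distrs_with_moments_def)
  ultimately show ?thesis by (auto simp: moments_def simp del: upt_Suc)
qed

text \<open>By Weierstrass, \<open>h\<close> is within \<open>e / 2\<close> of a polynomial, whose
  integral depends only on finitely many moments; the errors for \<open>F\<close> and
  \<open>F'\<close> add up to \<open>e\<close>. The polynomial does not depend on \<open>F'\<close>,
  which gives the uniformity that an infimum over \<open>F'\<close> requires.\<close>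

lemma eventually_integral_close:
  fixes h :: "real \<Rightarrow> real"
  assumes F: "F \<in> unit_distrs" and h: "continuous_on {0..1} h" "h \<in> borel_measurable borel" and "0 < e"
  shows "\<forall>\<^sub>F d in sequentially. \<forall>F' \<in> distrs_with_moments d (moments d F).
           (\<integral>x. h x \<partial>F) - e \<le> (\<integral>x. h x \<partial>F')"
proof -
  obtain g where "real_polynomial_function g" and g: "\<And>x. x \<in> {0..1} \<Longrightarrow> \<bar>h x - g x\<bar> < e / 2"
    using Stone_Weierstrass_real_polynomial_function[OF _ h(1), of "e / 2"] \<open>0 < e\<close> by auto
  then obtain c n where g_eq: "g = (\<lambda>x. \<Sum>i\<le>n. c i * x ^ i)"
    by (auto simp: real_polynomial_function_iff_sum)
  obtain B where B: "\<And>x. x \<in> {0..1} \<Longrightarrow> \<bar>h x\<bar> \<le> B"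
    using compact_imp_bounded[OF compact_continuous_image[OF h(1)]]
    by (auto simp: bounded_iff simp del: atLeastAtMost_iff)
  have close: "\<bar>(\<integral>x. h x \<partial>H) - (\<integral>x. g x \<partial>H)\<bar> \<le> e / 2"
    and g_int: "(\<integral>x. g x \<partial>H) = (\<Sum>i\<le>n. c i * (\<integral>x. x ^ i \<partial>H))" if H: "H \<in> unit_distrs" for H
  proof -
    note p = unit_distrs_integrable_power[OF H]
    show "(\<integral>x. g x \<partial>H) = (\<Sum>i\<le>n. c i * (\<integral>x. x ^ i \<partial>H))"
      unfolding g_eq using p by (subst Bochner_Integration.integral_sum) auto
    have "integrable H g" unfolding g_eq using p by auto
    then show "\<bar>(\<integral>x. h x \<partial>H) - (\<integral>x. g x \<partial>H)\<bar> \<le> e / 2"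
      using g by (intro integral_diff_le_unit_distrs H unit_distrs_integrable[OF H h(2) B]) (auto intro: less_imp_le)
  qed
  show ?thesis
  proof (rule eventually_sequentiallyI[of n], rule ballI)
    fix d F' assume "n \<le> d" and F': "F' \<in> distrs_with_moments d (moments d F)"
    then have "F' \<in> unit_distrs" by (simp add: distrs_with_moments_def)
    moreover have "(\<integral>x. g x \<partial>F') = (\<integral>x. g x \<partial>F)"
      using g_int F \<open>F' \<in> unit_distrs\<close> moments_eq_imp_integral_power_eq[OF F F'] \<open>n \<le> d\<close> by simp
    ultimately show "(\<integral>x. h x \<partial>F) - e \<le> (\<integral>x. h x \<partial>F')"
      using close[OF F] close[of F'] by linarith
  qed
qed

section \<open>The boundary case \<open>\<mu> = 1\<close>\<close>

text \<open>A distribution on \<open>[0,1]\<close> with mean at least 1 is the point mass at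
  \<open>1\<close>, and no \<open>F\<close> of smaller mean is absolutely continuous with respect to
  it.\<close>

lemma D_min_at_1:
  assumes F: "F \<in> unit_distrs" and "(\<integral>x. x \<partial>F) < 1"
  shows "D_min F 1 = \<infinity>"
proof -
  have "KL_div F G = \<infinity>" if G: "G \<in> unit_distrs" "1 \<le> (\<integral>x. x \<partial>G)" for G
  proof -
    interpret F: prob_space F using F by (rule unit_distrs_prob_space)
    interpret G: prob_space G using G(1) by (rule unit_distrs_prob_space)
    note int = unit_distrs_integrable_id[OF G(1)]
    have nn: "AE x in G. 0 \<le> 1 - x" using unit_distrs_AE[OF G(1)] by eventually_elim simp
    moreover have "(\<integral>x. 1 - x \<partial>G) = 0"
      using G int integral_nonneg_AE[OF nn] by (simp add: G.prob_space)
    ultimately have "AE x in G. 1 - x = 0"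
      using int by (subst integral_nonneg_eq_0_iff_AE[symmetric]) auto
    then have one: "AE x in G. x = 1" by eventually_elim simp
    have "\<not> absolutely_continuous G F"
    proof
      assume "absolutely_continuous G F"
      then have "AE x in F. x = 1"
        using one G F by (intro absolutely_continuous_AE[of F G]) (auto simp: unit_distrs_sets)
      then have "(\<integral>x. x \<partial>F) = (\<integral>x. 1 \<partial>F)"
        using F by (intro integral_cong_AE) (auto simp: unit_distrs_measurable)
      then show False using assms by (simp add: F.prob_space)
    qed
    then show ?thesis by (simp add: KL_div_def)
  qed
  then show ?thesis unfolding D_min_def by (auto intro!: INF_eqI simp: top_ereal_def[symmetric])
qed

section \<open>Passage to the limit\<close>

theorem theorem2:
  fixes F :: "real measure" and \<mu> :: real
  assumes "F \<in> unit_distrs" and "\<mu> \<in> {0..1}"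
  shows "(\<lambda>d. D_min_moments d (moments d F) \<mu>) \<longlonglongrightarrow> D_min F \<mu>"
proof -
  note F = assms(1)
  have upper: "D_min_moments d (moments d F) \<mu> \<le> D_min F \<mu>" for d
    unfolding D_min_moments_def using F by (intro INF_lower) (simp add: distrs_with_moments_def)
  have lower: "\<forall>\<^sub>F d in sequentially. y < D_min_moments d (moments d F) \<mu>" if y: "y < D_min F \<mu>" for y
  \<comment> \<open>\<open>D_min_le_dual\<close> requires \<open>\<mu> < 1\<close>. In the case
    split off here the value is infinite for every distribution with the same first moment, hence
    from \<open>d = 1\<close> on.\<close>
  proof (cases "\<mu> = 1 \<and> (\<integral>x. x \<partial>F) < 1")
    case True
    have "D_min_moments d (moments d F) \<mu> = \<infinity>" if "1 \<le> d" for d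
    proof -
      have "D_min F' \<mu> = \<infinity>" if F': "F' \<in> distrs_with_moments d (moments d F)" for F'
        using D_min_at_1[of F'] True F' moments_eq_imp_integral_power_eq[OF F F' \<open>1 \<le> d\<close>]
        by (simp add: distrs_with_moments_def)
      then show ?thesis
        unfolding D_min_moments_def by (auto intro!: INF_eqI simp: top_ereal_def[symmetric])
    qed
    then show ?thesis using y True by (intro eventually_sequentiallyI[of 1]) auto
  next
    case False
    obtain \<nu> where \<nu>: "0 \<le> \<nu>" "(1 - \<mu>) * \<nu> < 1" and less: "y < ereal (\<integral>x. ln (tilt \<mu> \<nu> x) \<partial>F)"
    proof (cases "\<mu> = 1")
      case True
      \<comment> \<open>Here \<open>F\<close> has mean at least 1 and is itself feasible, so the
        dual value 0 of the parameter 0 already exceeds \<open>y\<close>.\<close>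
      then have "y < 0" using False D_min_le_0[OF F, of \<mu>] y by (auto simp: not_less)
      then show thesis by (intro that[of 0]) (auto simp: tilt_def zero_ereal_def[symmetric])
    next
      case False
      then have \<mu>: "0 \<le> \<mu>" "\<mu> < 1" using assms by auto
      from y D_min_le_dual[OF F this]
      have "y < (SUP \<nu>\<in>{0..<1 / (1 - \<mu>)}. ereal (\<integral>x. ln (tilt \<mu> \<nu> x) \<partial>F))" by simp
      then obtain \<nu> where "\<nu> \<in> {0..<1 / (1 - \<mu>)}" "y < ereal (\<integral>x. ln (tilt \<mu> \<nu> x) \<partial>F)"
        by (auto simp: less_SUP_iff)
      then show thesis using \<mu> by (intro that[of \<nu>]) (auto simp: field_simps)
    qed
    \<comment> \<open>An infimum preserves only weak inequalities, so \<open>z\<close> keeps the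
      bound by \<open>y\<close> strict; its distance to the dual value is the error allowed in the
      approximation.\<close>
    obtain z where z: "y < ereal z" "ereal z < ereal (\<integral>x. ln (tilt \<mu> \<nu> x) \<partial>F)"
      using ereal_dense2[OF less] by auto
    have cont: "continuous_on {0..1} (\<lambda>x. ln (tilt \<mu> \<nu> x))"
    proof (rule continuous_on_ln)
      show "continuous_on {0..1} (tilt \<mu> \<nu>)" unfolding tilt_def by (intro continuous_intros)
      show "\<forall>x\<in>{0..1}. tilt \<mu> \<nu> x \<noteq> 0" using tilt_pos[OF \<nu>] by force
    qed
    have meas: "(\<lambda>x. ln (tilt \<mu> \<nu> x)) \<in> borel_measurable borel" by measurable
    have "\<forall>\<^sub>F d in sequentially. \<forall>F' \<in> distrs_with_moments d (moments d F).
        (\<integral>x. ln (tilt \<mu> \<nu> x) \<partial>F) - ((\<integral>x. ln (tilt \<mu> \<nu> x) \<partial>F) - z) \<le> (\<integral>x. ln (tilt \<mu> \<nu> x) \<partial>F')"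
      using z(2) by (intro eventually_integral_close[OF F cont meas]) simp
    then show ?thesis
    proof eventually_elim
      case (elim d)
      have "ereal z \<le> D_min_moments d (moments d F) \<mu>"
        unfolding D_min_moments_def
      proof (rule INF_greatest)
        fix F' assume F': "F' \<in> distrs_with_moments d (moments d F)"
        have "ereal z \<le> ereal (\<integral>x. ln (tilt \<mu> \<nu> x) \<partial>F')" using elim F' by simp
        also have "\<dots> \<le> D_min F' \<mu>"
          using F' \<nu> assms by (intro D_min_ge_integral_ln_tilt) (auto simp: distrs_with_moments_def)
        finally show "ereal z \<le> D_min F' \<mu>" .
      qed
      with z(1) show ?case by (rule less_le_trans)
    qed
  qed
  show ?thesis
  proof (rule order_tendstoI)
    fix y assume "D_min F \<mu> < y"
    then show "\<forall>\<^sub>F d in sequentially. D_min_moments d (moments d F) \<mu> < y"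
      by (intro always_eventually allI le_less_trans[OF upper])
  qed (rule lower)
qed

end
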